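(* Let $d$, $m$, and $n$ be positive integers with $dm\le n<2^m$. Then $f(n,d)\le dm$.
   Context: Write $[n]=\{1,2,\ldots,n\}$. For two positive integers $n$ and $d$, $f(n,d)$ denotes the least integer $f$ such that there exist $f$ subsets $A_1,A_2,\ldots,A_f$ of $[n]$ with the following property: for any two distinct subsets $X$ and $Y$ of $[n]$ each of size at most $d$, there exists an index $i\in[f]$ such that the cardinalities $|A_i\cap X|$ and $|A_i\cap Y|$ have different parity. *)

theory Defs
  imports Main
begin

definition parity_separating :: "nat \<Rightarrow> nat \<Rightarrow> nat \<Rightarrow> (nat \<Rightarrow> nat set) \<Rightarrow> bool" where
  "parity_separating n d k A \<longleftrightarrow>
     (\<forall>i\<in>{1..k}. A i \<subseteq> {1..n}) \<and>
     (\<forall>X Y. X \<subseteq> {1..n} \<and> Y \<subseteq> {1..n} \<and> card X \<le> d \<and> card Y \<le> d \<and> X \<noteq> Y \<longrightarrow>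
        (\<exists>i\<in>{1..k}. even (card (A i \<inter> X)) \<noteq> even (card (A i \<inter> Y))))"

definition min_separating :: "nat \<Rightarrow> nat \<Rightarrow> nat" where
  "min_separating n d = (LEAST k. \<exists>A. parity_separating n d k A)"

text \<open>The singletons always separate, so the minimum defining \<^const>\<open>min_separating\<close> is attained.\<close>

lemma parity_separating_singletons: "parity_separating n d n (\<lambda>i. {i})"
  unfolding parity_separating_def
proof (intro conjI ballI allI impI)
  fix X Y :: "nat set"
  assume "X \<subseteq> {1..n} \<and> Y \<subseteq> {1..n} \<and> card X \<le> d \<and> card Y \<le> d \<and> X \<noteq> Y"
  then obtain i where "i \<in> {1..n}" "(i \<in> X) \<noteq> (i \<in> Y)"
    by blast
  then show "\<exists>i\<in>{1..n}. even (card ({i} \<inter> X)) \<noteq> even (card ({i} \<inter> Y))"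
    by (intro bexI[of _ i]) auto
qed auto

lemma min_separating_attained: "\<exists>A. parity_separating n d (min_separating n d) A"
  unfolding min_separating_def by (rule LeastI_ex) (use parity_separating_singletons in blast)

end

theory Submission
  imports Defs "HOL-Algebra.Algebraic_Closure_Type" "HOL-Library.Z2"
begin

text \<open>
  The separating family is the parity-check matrix of a binary BCH code. Let \<open>F\<close> be the field with
  \<open>2 ^ m\<close> elements. As \<open>n < 2 ^ m\<close>, the points of \<open>{1..n}\<close> can be labelled by distinct nonzero
  elements \<open>\<alpha> j\<close> of \<open>F\<close>. A set \<open>S\<close> of points is measured by the \<open>d\<close> odd power sums
  \<open>\<Sum>j\<in>S. \<alpha> j ^ (2 * k + 1)\<close>, \<open>k < d\<close>. Each of them is an element of \<open>F\<close>, hence is described by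
  \<open>m\<close> coordinates over the two-element field, and each coordinate is additive: its value is the
  parity of the number of \<open>j \<in> S\<close> for which \<open>\<alpha> j ^ (2 * k + 1)\<close> has that coordinate equal
  to \<open>1\<close>. So \<open>d * m\<close> parities of intersections record all the odd power sums.

  These determine \<open>S\<close> when \<open>card S \<le> d\<close>. Squaring is additive in characteristic two, so the odd
  power sums up to exponent \<open>2 * d\<close> determine the even ones
  (\<open>power_sums_eq_if_odd_power_sums_eq\<close>). Two sets of size at most \<open>d\<close> have a union of size at most
  \<open>2 * d\<close>, and by a Vandermonde argument such sets of nonzero elements are equal if their first
  \<open>2 * d\<close> power sums agree (\<open>sets_eq_if_power_sums_eq\<close>).

  The field \<open>F\<close> is the set of roots of \<open>x ^ (2 ^ m) - x\<close> in the algebraic closure of the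
  two-element field (\<open>card_GF_two_power\<close>), and the coordinates come from a basis of it
  (\<open>binary_coordinates\<close>).
\<close>

section \<open>Power sums determine a set\<close>

text \<open>
  Agreement of the power sums makes \<open>\<Sum>x\<in>S. p x\<close> and \<open>\<Sum>x\<in>T. p x\<close> agree for every polynomial
  \<open>p\<close> of degree at most \<open>N\<close> without constant term. If \<open>z\<close> lies in exactly one of the sets, such a
  polynomial can be chosen to vanish on \<open>S \<union> T\<close> except at \<open>z\<close>, which separates the two sums.
  The exponent \<open>0\<close> is unavailable, since it counts elements; the factor \<open>x\<close> that replaces it
  costs one degree and forces the elements to be nonzero.
\<close>
lemma sets_eq_if_power_sums_eq:
  fixes S T :: "'a :: field set"
  assumes fin: "finite S" "finite T" and nz: "0 \<notin> S" "0 \<notin> T"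
    and card: "card (S \<union> T) \<le> N"
    and sums: "\<And>k. 1 \<le> k \<Longrightarrow> k \<le> N \<Longrightarrow> (\<Sum>x\<in>S. x ^ k) = (\<Sum>y\<in>T. y ^ k)"
  shows "S = T"
proof (rule ccontr)
  assume "S \<noteq> T"
  then obtain z where z: "z \<in> S \<union> T" "z \<in> S \<longleftrightarrow> z \<notin> T" by blast
  define p where "p = [:0, 1:] * (\<Prod>x\<in>(S \<union> T) - {z}. [:- x, 1:])"
  have deg: "degree p \<le> N"
  proof -
    have "degree p = Suc (card ((S \<union> T) - {z}))"
      unfolding p_def by (subst degree_mult_eq) (auto simp: degree_prod_sum_eq fin)
    also have "\<dots> = card (S \<union> T)"
      using z fin by (intro card_Suc_Diff1) auto
    finally show ?thesis using card by simp
  qed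
  have p0: "coeff p 0 = 0"
    by (simp add: p_def coeff_mult)
  have p_sum: "(\<Sum>x\<in>Z. poly p x) = (\<Sum>k=1..N. coeff p k * (\<Sum>x\<in>Z. x ^ k))" for Z
  proof -
    have "poly p x = (\<Sum>k=1..N. coeff p k * x ^ k)" for x
    proof -
      have "poly p x = (\<Sum>k\<le>N. coeff p k * x ^ k)"
        unfolding poly_altdef using deg
        by (intro sum.mono_neutral_left) (auto simp: coeff_eq_0)
      also have "\<dots> = (\<Sum>k=1..N. coeff p k * x ^ k)"
        using p0 by (intro sum.mono_neutral_right) (auto simp: not_less_eq_eq)
      finally show ?thesis .
    qed
    then show ?thesis
      by (simp add: sum_distrib_left sum.swap[of _ Z])
  qed
  have vanish: "poly p x = 0" if "x \<in> S \<union> T" "x \<noteq> z" for x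
    using that fin by (auto simp: p_def poly_prod)
  have p_z: "(\<Sum>x\<in>Z. poly p x) = (if z \<in> Z then poly p z else 0)" if "Z \<subseteq> S \<union> T" for Z
  proof -
    have "finite Z" using that fin by (meson finite_UnI finite_subset)
    then have "(\<Sum>x\<in>Z. if x = z then poly p z else 0) = (if z \<in> Z then poly p z else 0)"
      by simp
    moreover have "(\<Sum>x\<in>Z. poly p x) = (\<Sum>x\<in>Z. if x = z then poly p z else 0)"
      by (rule sum.cong) (use vanish that in auto)
    ultimately show ?thesis by simp
  qed
  have "(\<Sum>x\<in>S. poly p x) = (\<Sum>y\<in>T. poly p y)"
    unfolding p_sum by (rule sum.cong) (auto simp: sums)
  then have "poly p z = 0"
    using z p_z[of S] p_z[of T] by (auto split: if_splits)
  moreover have "poly p z \<noteq> 0"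
    using z nz fin by (auto simp: p_def poly_prod)
  ultimately show False by simp
qed

text \<open>
  By additivity of squaring, the power sum with exponent \<open>2 * l\<close> is the square of the one with
  exponent \<open>l\<close>.
\<close>
lemma power_sums_eq_if_odd_power_sums_eq:
  fixes S T :: "'a :: field set"
  assumes char: "CHAR('a) = 2"
    and odd_sums: "\<And>k. k < d \<Longrightarrow> (\<Sum>x\<in>S. x ^ (2 * k + 1)) = (\<Sum>y\<in>T. y ^ (2 * k + 1))"
    and "1 \<le> k" "k \<le> 2 * d"
  shows "(\<Sum>x\<in>S. x ^ k) = (\<Sum>y\<in>T. y ^ k)"
  using assms(3,4)
proof (induction k rule: less_induct)
  case (less k)
  show ?case
  proof (cases "even k")
    case True
    then obtain l where l: "k = l * 2" by (auto elim: evenE)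
    have square: "(\<Sum>x\<in>Z. x ^ k) = (\<Sum>x\<in>Z. x ^ l) ^ 2" for Z :: "'a set"
      by (simp add: freshmans_dream_sum[of 2] char two_is_prime_nat l power_mult)
    show ?thesis
      unfolding square using less l by simp
  next
    case False
    then obtain l where "k = 2 * l + 1" by (auto elim: oddE)
    then show ?thesis
      using odd_sums[of l] less.prems by auto
  qed
qed

section \<open>A field of order a power of two\<close>

text \<open>
  Over an algebraically closed field \<open>p\<close> is a product of \<open>degree p\<close> linear factors, and a repeated
  factor would make its root also a root of the derivative.
\<close>
lemma card_roots_if_separable:
  fixes p :: "'a :: alg_closed_field poly"
  assumes sep: "\<And>a. poly p a = 0 \<Longrightarrow> poly (pderiv p) a \<noteq> 0"
  shows "card {a. poly p a = 0} = degree p"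
proof -
  have nz: "p \<noteq> 0" using sep[of 0] by auto
  then obtain M where M: "size M = degree p"
      "p = smult (lead_coeff p) (\<Prod>x\<in>#M. [:-x, 1:])"
    using alg_closed_imp_factorization by blast
  have roots: "poly p a = 0 \<longleftrightarrow> a \<in># M" for a
    by (subst M(2)) (auto simp: nz poly_prod_mset prod_mset_zero_iff)
  have "count M a = 1" if "a \<in># M" for a
  proof (rule ccontr)
    obtain M' where M': "M = add_mset a M'"
      using \<open>a \<in># M\<close> by (meson multi_member_split)
    define q where "q = smult (lead_coeff p) (\<Prod>x\<in>#M'. [:-x, 1:])"
    assume "count M a \<noteq> 1"
    then have "a \<in># M'"
      by (simp add: M' not_in_iff)
    then have "poly q a = 0"
      by (auto simp: q_def poly_prod_mset prod_mset_zero_iff)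
    moreover have "p = [:-a, 1:] * q"
      by (subst M(2)) (simp add: M' q_def)
    ultimately have "poly p a = 0" "poly (pderiv p) a = 0"
      by (simp_all only: pderiv_mult poly_add poly_mult) simp_all
    then show False using sep by blast
  qed
  then have "card (set_mset M) = size M"
    by (simp add: size_multiset_overloaded_eq)
  then show ?thesis
    by (simp add: roots M(1))
qed

lemma CHAR_bit: "CHAR(bit) = 2"
proof (rule CHAR_eqI)
  show "2 dvd n" if "of_nat n = (0 :: bit)" for n
    using that by (metis even_of_nat even_zero)
qed simp

text \<open>
  The field of order \<open>2 ^ m\<close> (for positive \<open>m\<close>), realised inside one fixed algebraic closure as the
  fixed points of the \<open>m\<close>-fold iterate of the Frobenius map.
\<close>
definition GF_two_power :: "nat \<Rightarrow> bit alg_closure set" where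
  "GF_two_power m = {x. x ^ (2 ^ m) = x}"

lemma GF_two_power_power: "x \<in> GF_two_power m \<Longrightarrow> x ^ k \<in> GF_two_power m"
  unfolding GF_two_power_def mem_Collect_eq
  by (metis mult.commute power_mult)

lemma GF_two_power_zero: "0 \<in> GF_two_power m"
  by (simp add: GF_two_power_def)

lemma GF_two_power_add: "x \<in> GF_two_power m \<Longrightarrow> y \<in> GF_two_power m \<Longrightarrow> x + y \<in> GF_two_power m"
  by (simp add: GF_two_power_def freshmans_dream'[of "2 ^ m" m] CHAR_bit)

text \<open>
  The polynomial \<open>x ^ (2 ^ m) - x\<close> is separable: its derivative is the constant \<open>- 1\<close>. For \<open>m = 0\<close>
  it is the zero polynomial, and every element of the closure is a root.
\<close>
lemma card_GF_two_power:
  assumes "0 < m"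
  shows "card (GF_two_power m) = 2 ^ m"
proof -
  define p :: "bit alg_closure poly" where "p = monom 1 (2 ^ m) + monom (- 1) 1"
  have two: "of_nat (2 ^ m) = (0 :: bit alg_closure)"
    using assms by (simp only: of_nat_eq_0_iff_char_dvd CHAR_alg_closure CHAR_bit) simp
  have "1 < (2::nat) ^ m" by (rule one_less_power) (use assms in auto)
  then have "degree p = 2 ^ m"
    unfolding p_def by (subst degree_add_eq_left) (auto simp: degree_monom_eq)
  moreover have "GF_two_power m = {x. poly p x = 0}"
    by (auto simp: GF_two_power_def p_def poly_monom)
  moreover have "poly (pderiv p) a \<noteq> 0" for a
    using two assms by (simp add: p_def pderiv_add pderiv_monom poly_monom power_0_left)
  ultimately show ?thesis
    using card_roots_if_separable[of p] by simp
qed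

section \<open>Coordinates modulo two\<close>

text \<open>
  The functions \<open>\<phi> b\<close> are the coordinates with respect to a basis \<open>B\<close> of the space spanned by \<open>F\<close>.
  The basis has at most \<open>m\<close> elements because distinct subsets of it have distinct sums, all of
  which lie in \<open>F\<close>.
\<close>
lemma binary_coordinates:
  fixes scale :: "bit \<Rightarrow> 'v \<Rightarrow> 'v :: ab_group_add" and F :: "'v set"
  assumes "vector_space scale"
    and zero: "0 \<in> F" and add: "\<And>x y. x \<in> F \<Longrightarrow> y \<in> F \<Longrightarrow> x + y \<in> F"
    and fin: "finite F" and card: "card F \<le> 2 ^ m"
  shows "\<exists>(B :: 'v set) (\<phi> :: 'v \<Rightarrow> 'v \<Rightarrow> bit). finite B \<and> card B \<le> m \<and>
    (\<forall>b (I :: 'i set) v. (\<forall>i\<in>I. v i \<in> F) \<longrightarrow> \<phi> b (\<Sum>i\<in>I. v i) = (\<Sum>i\<in>I. \<phi> b (v i))) \<and>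
    (\<forall>x\<in>F. \<forall>y\<in>F. (\<forall>b\<in>B. \<phi> b x = \<phi> b y) \<longrightarrow> x = y)"
proof -
  interpret vector_space scale by fact
  obtain B where B: "B \<subseteq> F" "independent B" "F \<subseteq> span B"
    using maximal_independent_subset[of F] by blast
  have finB: "finite B" using B(1) fin by (rule finite_subset)
  define \<phi> where "\<phi> b x = representation B x b" for b x
  \<comment> \<open>A subset is recovered from its sum as the set of coordinates equal to \<open>1\<close>.\<close>
  have "inj_on (\<lambda>S. \<Sum>b\<in>S. b) (Pow B)"
  proof (rule inj_on_inverseI)
    fix S assume "S \<in> Pow B"
    then have "representation B (\<Sum>b\<in>S. b) = (\<lambda>c. \<Sum>b\<in>S. representation B b c)"
      by (intro representation_sum B) (auto intro: span_base)
    also have "\<dots> = (\<lambda>c. \<Sum>b\<in>S. if c = b then 1 else 0)"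
      using \<open>S \<in> Pow B\<close> B(2) by (intro ext sum.cong) (auto simp: representation_basis)
    also have "\<dots> = (\<lambda>c. if c \<in> S then 1 else 0)"
      using \<open>S \<in> Pow B\<close> finB by (auto simp: finite_subset)
    finally show "{c. representation B (\<Sum>b\<in>S. b) c = 1} = S"
      by auto
  qed
  moreover have "(\<Sum>b\<in>S. b) \<in> F" if "S \<subseteq> B" for S
    using finite_subset[OF that finB] that
    by (induction S rule: finite_induct) (use zero add B(1) in auto)
  ultimately have "card (Pow B) \<le> card F"
    by (intro card_inj_on_le[OF _ _ fin]) auto
  then have "(2::nat) ^ card B \<le> 2 ^ m"
    using card by (simp only: card_Pow[OF finB])
  then have cardB: "card B \<le> m" by (rule power_le_imp_le_exp[rotated]) simp
  have sum: "\<phi> b (\<Sum>i\<in>I. v i) = (\<Sum>i\<in>I. \<phi> b (v i))"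
    if "\<forall>i\<in>I. v i \<in> F" for b v and I :: "'i set"
    unfolding \<phi>_def using that B by (subst representation_sum) auto
  have inj: "x = y" if "x \<in> F" "y \<in> F" "\<forall>b\<in>B. \<phi> b x = \<phi> b y" for x y
  proof -
    have "x = (\<Sum>b\<in>B. scale (\<phi> b x) b)"
      using that B finB unfolding \<phi>_def by (subst sum_representation_eq) auto
    also have "\<dots> = (\<Sum>b\<in>B. scale (\<phi> b y) b)"
      using that by simp
    also have "\<dots> = y"
      using that B finB unfolding \<phi>_def by (subst sum_representation_eq) auto
    finally show ?thesis .
  qed
  show ?thesis
    using finB cardB sum inj by (intro exI[of _ B] exI[of _ \<phi>]) simp
qed

lemma sum_bit_eq_of_bool_odd_card:
  fixes f :: "'i \<Rightarrow> bit"
  assumes "finite S"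
  shows "(\<Sum>i\<in>S. f i) = of_bool (odd (card {i \<in> S. f i = 1}))"
proof -
  have "(\<Sum>i\<in>S. f i) = (\<Sum>i\<in>S. if f i = 1 then 1 else 0)"
    by (rule sum.cong) auto
  also have "\<dots> = of_nat (card {i \<in> S. f i = 1})"
    by (simp add: sum.If_cases assms Int_def)
  also have "\<dots> = of_bool (odd (card {i \<in> S. f i = 1}))"
    by (simp only: Z2.bit_eq_iff even_of_nat) simp
  finally show ?thesis .
qed

section \<open>The separating family\<close>

theorem theorem1p2:
  fixes d m n :: nat
  assumes "0 < d" and "0 < m" and "0 < n"
    and "d * m \<le> n" and "n < 2 ^ m"
  shows "min_separating n d \<le> d * m"
proof -
  have finF: "finite (GF_two_power m)"
    using card_GF_two_power[OF \<open>0 < m\<close>] by (metis card.infinite power_not_zero zero_neq_numeral)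
  have "card (GF_two_power m - {0}) = 2 ^ m - 1"
    by (simp add: card_Diff_singleton GF_two_power_zero card_GF_two_power \<open>0 < m\<close>)
  then have "card {1..n} \<le> card (GF_two_power m - {0})"
    using \<open>n < 2 ^ m\<close> by simp
  then obtain \<alpha> where \<alpha>: "\<alpha> ` {1..n} \<subseteq> GF_two_power m - {0}" "inj_on \<alpha> {1..n}"
    using card_le_inj[of "{1..n}" "GF_two_power m - {0}"] finF by auto
  have vs: "vector_space (\<lambda>c (x :: bit alg_closure). to_ac c * x)"
    by standard (simp_all only: to_ac_add to_ac_mult to_ac_1 ring_distribs mult.assoc mult_1)
  obtain B :: "bit alg_closure set" and \<phi> :: "bit alg_closure \<Rightarrow> bit alg_closure \<Rightarrow> bit"
    where finB: "finite B" and cardB: "card B \<le> m"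
    and \<phi>_sum: "\<forall>b (I :: nat set) v. (\<forall>i\<in>I. v i \<in> GF_two_power m) \<longrightarrow>
      \<phi> b (\<Sum>i\<in>I. v i) = (\<Sum>i\<in>I. \<phi> b (v i))"
    and \<phi>_inj: "\<forall>x\<in>GF_two_power m. \<forall>y\<in>GF_two_power m. (\<forall>b\<in>B. \<phi> b x = \<phi> b y) \<longrightarrow> x = y"
    using binary_coordinates[OF vs GF_two_power_zero GF_two_power_add finF eq_refl[OF card_GF_two_power[OF \<open>0 < m\<close>]],
        where 'i = nat]
    by blast

  \<comment> \<open>The rows of the parity-check matrix: coordinate \<open>b\<close> of the odd power with exponent
    \<open>2 * k + 1\<close>.\<close>
  define A where "A = (\<lambda>(k, b). {j \<in> {1..n}. \<phi> b (\<alpha> j ^ (2 * k + 1)) = 1})"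
  have separates: "S = T"
    if S: "S \<subseteq> {1..n}" "card S \<le> d" and T: "T \<subseteq> {1..n}" "card T \<le> d"
      and par: "\<And>i. i \<in> {..<d} \<times> B \<Longrightarrow> even (card (A i \<inter> S)) = even (card (A i \<inter> T))"
    for S T
  proof -
    have fin: "finite S" "finite T" using S T by (auto intro: finite_subset)
    have \<alpha>_mem: "\<alpha> j ^ k \<in> GF_two_power m" if "j \<in> Z" "Z \<subseteq> {1..n}" for j k Z
      using that \<alpha>(1) by (intro GF_two_power_power) auto
    have sum_mem: "(\<Sum>j\<in>Z. \<alpha> j ^ k) \<in> GF_two_power m" if "finite Z" "Z \<subseteq> {1..n}" for Z k
      using that
      by (induction Z rule: finite_induct) (simp_all add: GF_two_power_zero GF_two_power_add \<alpha>_mem[of _ "{1..n}"])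
    have coordinate: "\<phi> b (\<Sum>j\<in>Z. \<alpha> j ^ (2 * k + 1)) = of_bool (odd (card (A (k, b) \<inter> Z)))"
      if Z: "finite Z" "Z \<subseteq> {1..n}" for Z k b
    proof -
      have "A (k, b) \<inter> Z = {j \<in> Z. \<phi> b (\<alpha> j ^ (2 * k + 1)) = 1}"
        using Z by (auto simp: A_def)
      then show ?thesis
        using \<phi>_sum[rule_format, of Z, OF \<alpha>_mem[OF _ Z(2)]]
        by (simp only: sum_bit_eq_of_bool_odd_card[OF Z(1)])
    qed
    have reindex: "(\<Sum>x\<in>\<alpha> ` Z. x ^ k) = (\<Sum>j\<in>Z. \<alpha> j ^ k)" if "Z \<subseteq> {1..n}" for Z k
      using sum.reindex[OF inj_on_subset[OF \<alpha>(2) that]] by simp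
    have odd_sums: "(\<Sum>x\<in>\<alpha> ` S. x ^ (2 * k + 1)) = (\<Sum>y\<in>\<alpha> ` T. y ^ (2 * k + 1))" if "k < d" for k
      unfolding reindex[OF S(1)] reindex[OF T(1)]
    proof (rule \<phi>_inj[rule_format, OF sum_mem sum_mem])
      show "\<phi> b (\<Sum>j\<in>S. \<alpha> j ^ (2 * k + 1)) = \<phi> b (\<Sum>j\<in>T. \<alpha> j ^ (2 * k + 1))"
        if "b \<in> B" for b
        unfolding coordinate[OF fin(1) S(1)] coordinate[OF fin(2) T(1)]
        using par[of "(k, b)"] \<open>k < d\<close> \<open>b \<in> B\<close> by simp
    qed (use fin S T in auto)
    have "\<alpha> ` S = \<alpha> ` T"
    proof (rule sets_eq_if_power_sums_eq)
      have "card (\<alpha> ` S \<union> \<alpha> ` T) \<le> card (S \<union> T)"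
        unfolding image_Un[symmetric] using fin by (intro card_image_le) auto
      also have "\<dots> \<le> 2 * d"
        using card_Un_le[of S T] S T by linarith
      finally show "card (\<alpha> ` S \<union> \<alpha> ` T) \<le> 2 * d" .
      show "(\<Sum>x\<in>\<alpha> ` S. x ^ k) = (\<Sum>y\<in>\<alpha> ` T. y ^ k)" if "1 \<le> k" "k \<le> 2 * d" for k
        using power_sums_eq_if_odd_power_sums_eq[OF _ odd_sums that] by (simp add: CHAR_bit)
    qed (use fin S T \<alpha>(1) in auto)
    then show "S = T"
      using inj_on_image_eq_iff[OF \<alpha>(2)] S T by simp
  qed

  \<comment> \<open>The family is indexed by pairs, so it has to be enumerated by an initial segment.\<close>
  define N where "N = card ({..<d} \<times> B)"
  obtain h where h: "bij_betw h {1..N} ({..<d} \<times> B)"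
    using ex_bij_betw_nat_finite_1[of "{..<d} \<times> B"] finB unfolding N_def by auto
  have "parity_separating n d N (A \<circ> h)"
    unfolding parity_separating_def
  proof (intro conjI ballI allI impI)
    show "(A \<circ> h) i \<subseteq> {1..n}" for i
      by (auto simp: A_def split: prod.splits)
    fix S T :: "nat set"
    assume ST: "S \<subseteq> {1..n} \<and> T \<subseteq> {1..n} \<and> card S \<le> d \<and> card T \<le> d \<and> S \<noteq> T"
    then obtain i where "i \<in> {..<d} \<times> B" "even (card (A i \<inter> S)) \<noteq> even (card (A i \<inter> T))"
      using separates[of S T] by blast
    then show "\<exists>i\<in>{1..N}. even (card ((A \<circ> h) i \<inter> S)) \<noteq> even (card ((A \<circ> h) i \<inter> T))"
      using bij_betw_imp_surj_on[OF h] by (metis comp_apply imageE)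
  qed
  then have "min_separating n d \<le> N"
    unfolding min_separating_def by (intro Least_le) blast
  also have "N \<le> d * m"
    using cardB by (simp add: N_def card_cartesian_product)
  finally show ?thesis .
qed

end
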